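(* The minimum number of monochromatic triangles in a line $2$-coloring of the Pappus configuration, taken over all line $2$-colorings, is $0$.
   Context: A configuration is a pair $(\mathcal{P},\mathcal{L})$ with $\mathcal{P}$ a finite set of points and $\mathcal{L}$ a finite set of subsets of $\mathcal{P}$ called lines, such that any two distinct points lie together on at most one line, all points are on the same number of lines, all lines contain the same number of points, and there are at least three points. Three points $p_1,p_2,p_3$ form a triangle if there are lines $l_1,l_2,l_3$ with $p_1,p_2\in l_1$, $p_3\notin l_1$; $p_2,p_3\in l_2$, $p_1\notin l_2$; $p_1,p_3\in l_3$, $p_2\notin l_3$. The lines $l_1,l_2,l_3$ are then uniquely determined by the points. A line $2$-coloring assigns to each line one of the colors red, blue. A triangle is monochromatic if its lines $l_1,l_2,l_3$ all have the same color. The Pappus configuration is the $9_3$ configuration with points $A,B,C,a,b,c,X,Y,Z$ and lines $\{A,B,C\}$, $\{a,b,c\}$, $\{X,Y,Z\}$, $\{A,b,X\}$, $\{a,B,X\}$, $\{A,c,Y\}$, $\{a,C,Y\}$, $\{B,c,Z\}$, $\{b,C,Z\}$. *)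

theory Defs
  imports Main "HOL-Library.FuncSet"
begin

definition configuration :: "'p set \<Rightarrow> 'p set set \<Rightarrow> bool" where
  "configuration P L \<longleftrightarrow>
     finite P \<and> finite L \<and> (\<forall>l\<in>L. l \<subseteq> P) \<and>
     (\<forall>p\<in>P. \<forall>q\<in>P. p \<noteq> q \<longrightarrow> (\<forall>l\<in>L. \<forall>m\<in>L. p \<in> l \<and> q \<in> l \<and> p \<in> m \<and> q \<in> m \<longrightarrow> l = m)) \<and>
     (\<exists>r. \<forall>p\<in>P. card {l \<in> L. p \<in> l} = r) \<and>
     (\<exists>k. \<forall>l\<in>L. card l = k) \<and>
     card P \<ge> 3"

text \<open>The incidence conditions force the three points to be distinct.\<close>

definition triangle_with_lines ::
    "'p set \<Rightarrow> 'p set set \<Rightarrow> 'p \<Rightarrow> 'p \<Rightarrow> 'p \<Rightarrow> 'p set \<Rightarrow> 'p set \<Rightarrow> 'p set \<Rightarrow> bool" where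
  "triangle_with_lines P L p1 p2 p3 l1 l2 l3 \<longleftrightarrow>
     p1 \<in> P \<and> p2 \<in> P \<and> p3 \<in> P \<and> l1 \<in> L \<and> l2 \<in> L \<and> l3 \<in> L \<and>
     p1 \<in> l1 \<and> p2 \<in> l1 \<and> p3 \<notin> l1 \<and>
     p2 \<in> l2 \<and> p3 \<in> l2 \<and> p1 \<notin> l2 \<and>
     p1 \<in> l3 \<and> p3 \<in> l3 \<and> p2 \<notin> l3"

lemma triangle_lines_unique:
  assumes "configuration P L"
    and "triangle_with_lines P L p1 p2 p3 l1 l2 l3"
    and "triangle_with_lines P L p1 p2 p3 m1 m2 m3"
  shows "l1 = m1 \<and> l2 = m2 \<and> l3 = m3"
proof -
  have u: "l = m" if "p \<in> P" "q \<in> P" "p \<noteq> q" "l \<in> L" "m \<in> L" "p \<in> l" "q \<in> l" "p \<in> m" "q \<in> m"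
    for p q l m
    using assms(1) that unfolding configuration_def by blast
  have d: "p1 \<noteq> p2" "p2 \<noteq> p3" "p1 \<noteq> p3"
    using assms(2) unfolding triangle_with_lines_def by auto
  show ?thesis
    using assms(2,3) u[OF _ _ d(1)] u[OF _ _ d(2)] u[OF _ _ d(3)]
    unfolding triangle_with_lines_def by simp
qed

datatype color = Red | Blue

text \<open>Colorings are extensional, so that each coloring of \<open>L\<close> is represented by exactly one
  function.\<close>

definition line_colorings :: "'p set set \<Rightarrow> ('p set \<Rightarrow> color) set" where
  "line_colorings L = L \<rightarrow>\<^sub>E UNIV"

text \<open>Triangles are counted as unordered sets of three points. By uniqueness of the lines of a
  triangle, the existential quantifier over the lines could equally be a universal one.\<close>

definition monochromatic_triangles ::
    "'p set \<Rightarrow> 'p set set \<Rightarrow> ('p set \<Rightarrow> color) \<Rightarrow> 'p set set" where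
  "monochromatic_triangles P L \<chi> =
     {{p1, p2, p3} | p1 p2 p3.
        \<exists>l1 l2 l3. triangle_with_lines P L p1 p2 p3 l1 l2 l3 \<and> \<chi> l1 = \<chi> l2 \<and> \<chi> l2 = \<chi> l3}"

text \<open>The following two finiteness facts ensure that \<^const>\<open>card\<close> and \<^const>\<open>Min\<close> have their
  usual meaning.\<close>

lemma finite_monochromatic_triangles:
  "configuration P L \<Longrightarrow> finite (monochromatic_triangles P L \<chi>)"
  by (rule finite_subset[of _ "Pow P"])
     (auto simp: monochromatic_triangles_def triangle_with_lines_def configuration_def)

lemma finite_line_colorings:
  assumes "configuration P L"
  shows "finite (line_colorings L)"
proof -
  have "(UNIV :: color set) \<subseteq> {Red, Blue}"
    using color.exhaust by blast
  then have "finite (UNIV :: color set)"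
    by (rule finite_subset) simp
  then show ?thesis
    using assms by (auto simp: line_colorings_def configuration_def intro: finite_PiE)
qed

datatype pappus_point = PA | PB | PC | Pa | Pb | Pc | PX | PY | PZ

definition pappus_points :: "pappus_point set" where
  "pappus_points = {PA, PB, PC, Pa, Pb, Pc, PX, PY, PZ}"

definition pappus_lines :: "pappus_point set set" where
  "pappus_lines =
     {{PA, PB, PC}, {Pa, Pb, Pc}, {PX, PY, PZ},
      {PA, Pb, PX}, {Pa, PB, PX},
      {PA, Pc, PY}, {Pa, PC, PY},
      {PB, Pc, PZ}, {Pb, PC, PZ}}"

lemma pappus_configuration: "configuration pappus_points pappus_lines"
proof -
  have "card {l \<in> pappus_lines. p \<in> l} = 3" for p
  proof -
    have "card {l \<in> pappus_lines. p \<in> l} = (\<Sum>l\<in>pappus_lines. if p \<in> l then 1 else 0)"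
      by (simp add: pappus_lines_def sum.If_cases Int_def del: insert_iff)
    also have "\<dots> = 3"
      unfolding pappus_lines_def by (cases p) (simp_all add: set_eq_subset)
    finally show ?thesis .
  qed
  then have "\<forall>p\<in>pappus_points. card {l \<in> pappus_lines. p \<in> l} = 3"
    by blast
  moreover have "\<forall>l\<in>pappus_lines. card l = 3"
    unfolding pappus_lines_def by simp
  moreover have "\<forall>p\<in>pappus_points. \<forall>q\<in>pappus_points. p \<noteq> q \<longrightarrow>
      (\<forall>l\<in>pappus_lines. \<forall>m\<in>pappus_lines. p \<in> l \<and> q \<in> l \<and> p \<in> m \<and> q \<in> m \<longrightarrow> l = m)"
    unfolding pappus_points_def pappus_lines_def by simp
  moreover have "finite pappus_points" "finite pappus_lines" "card pappus_points \<ge> 3"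
      "\<forall>l\<in>pappus_lines. l \<subseteq> pappus_points"
    unfolding pappus_points_def pappus_lines_def by simp_all
  ultimately show ?thesis
    unfolding configuration_def by blast
qed

end

theory Submission
  imports Defs "HOL-Library.Disjoint_Sets"
begin

text \<open>The nine lines of the Pappus configuration split into three parallel classes of three
  pairwise disjoint lines. The lines of a triangle are distinct and meet pairwise, so every
  triangle uses one line of each class. Colouring one class red and the other two blue
  therefore leaves no triangle monochromatic.\<close>

lemma monochromatic_triangles_empty_if_parallel_classes:
  assumes L: "L \<subseteq> K1 \<union> K2 \<union> K3"
    and disj: "disjoint K1" "disjoint K2" "disjoint K3"
    and red: "\<And>l. l \<in> L \<Longrightarrow> l \<in> K1 \<Longrightarrow> \<chi> l = Red"
    and blue: "\<And>l. l \<in> L \<Longrightarrow> l \<notin> K1 \<Longrightarrow> \<chi> l = Blue"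
  shows "monochromatic_triangles P L \<chi> = {}"
proof -
  have False
    if t: "triangle_with_lines P L p1 p2 p3 l1 l2 l3" and mono: "\<chi> l1 = \<chi> l2" "\<chi> l2 = \<chi> l3"
    for p1 p2 p3 l1 l2 l3
  proof -
    \<comment> \<open>Any two sides share a vertex, and each side omits the vertex common to the
      other two.\<close>
    have lines: "l1 \<in> L" "l2 \<in> L" "l3 \<in> L"
      and meet: "l1 \<inter> l2 \<noteq> {}" "l2 \<inter> l3 \<noteq> {}" "l1 \<inter> l3 \<noteq> {}"
      and distinct: "l1 \<noteq> l2" "l2 \<noteq> l3" "l1 \<noteq> l3"
      using t unfolding triangle_with_lines_def by blast+
    have apart: "\<not> (l1 \<in> K \<and> l2 \<in> K)" "\<not> (l2 \<in> K \<and> l3 \<in> K)" "\<not> (l1 \<in> K \<and> l3 \<in> K)"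
      if "disjoint K" for K
      using disjointD[OF that] meet distinct by blast+
    \<comment> \<open>On \<open>L\<close> the color of a line tells whether it lies in
      \<open>K1\<close>.\<close>
    have same: "l1 \<in> K1 \<longleftrightarrow> l2 \<in> K1" "l2 \<in> K1 \<longleftrightarrow> l3 \<in> K1"
      using red blue lines mono color.distinct by metis+
    \<comment> \<open>Either all three sides lie in \<open>K1\<close>, or none does and by
      pigeonhole two of them share \<open>K2\<close> or \<open>K3\<close>; \<open>apart\<close>
      excludes both.\<close>
    show False
      using same apart[OF disj(1)] apart[OF disj(2)] apart[OF disj(3)] L lines by blast
  qed
  then show ?thesis
    unfolding monochromatic_triangles_def by blast
qed

lemma pappus_coloring_without_monochromatic_triangles:
  "\<exists>\<chi>\<in>line_colorings pappus_lines. monochromatic_triangles pappus_points pappus_lines \<chi> = {}"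
proof -
  \<comment> \<open>The six lines outside \<open>K1\<close> split by cyclic shift: \<open>K2\<close>
    joins \<open>PA\<close>, \<open>PB\<close>, \<open>PC\<close> to \<open>Pb\<close>,
    \<open>Pc\<close>, \<open>Pa\<close>, and \<open>K3\<close> joins them to \<open>Pc\<close>,
    \<open>Pa\<close>, \<open>Pb\<close>.\<close>
  define K1 where "K1 = {{PA, PB, PC}, {Pa, Pb, Pc}, {PX, PY, PZ}}"
  define K2 where "K2 = {{PA, Pb, PX}, {Pa, PC, PY}, {PB, Pc, PZ}}"
  define K3 where "K3 = {{Pa, PB, PX}, {PA, Pc, PY}, {Pb, PC, PZ}}"
  define \<chi> where "\<chi> = restrict (\<lambda>l. if l \<in> K1 then Red else Blue) pappus_lines"
  have "\<chi> \<in> line_colorings pappus_lines"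
    unfolding \<chi>_def line_colorings_def by simp
  moreover have "pappus_lines \<subseteq> K1 \<union> K2 \<union> K3"
    unfolding pappus_lines_def K1_def K2_def K3_def by (simp only: insert_subset empty_subsetI Un_iff insert_iff simp_thms)
  moreover have "disjoint K1" "disjoint K2" "disjoint K3"
    unfolding K1_def K2_def K3_def pairwise_def disjnt_def by simp_all
  ultimately show ?thesis
    using monochromatic_triangles_empty_if_parallel_classes[of pappus_lines K1 K2 K3 \<chi>]
    by (auto simp: \<chi>_def)
qed

theorem theorem4p5:
  "Min ((\<lambda>\<chi>. card (monochromatic_triangles pappus_points pappus_lines \<chi>)) ` line_colorings pappus_lines) = 0"
proof -
  obtain \<chi> where "\<chi> \<in> line_colorings pappus_lines"
    and "monochromatic_triangles pappus_points pappus_lines \<chi> = {}"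
    using pappus_coloring_without_monochromatic_triangles by blast
  then have "0 \<in> (\<lambda>\<chi>. card (monochromatic_triangles pappus_points pappus_lines \<chi>)) `
      line_colorings pappus_lines"
    by (intro image_eqI[of _ _ \<chi>]) simp_all
  then show ?thesis
    \<comment> \<open>The value \<open>0\<close> is attained, and it is a lower bound because
      cardinalities are natural numbers.\<close>
    using finite_line_colorings[OF pappus_configuration] by (intro Min_eqI) auto
qed

end
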